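(* Let $L$ be a locally compact group and let $A_\Gamma$ be a right-angled Artin group, equipped with the discrete topology. Then any abstract group homomorphism $L\to A_\Gamma$ is continuous.
   Context: All topological groups are assumed Hausdorff. An abstract group homomorphism is a group homomorphism that is not assumed to be continuous. For a finite simplicial graph $\Gamma$ with vertex set $V$, the right-angled Artin group is $A_\Gamma=\langle V\mid vw=wv \text{ whenever } v,w \text{ are adjacent in }\Gamma\rangle$. *)

theory Defs
  imports
    "HOL-Analysis.Analysis"
    "HOL-Algebra.Group"
    "Graph_Theory.Pair_Digraph"
begin

section \<open>Topological groups\<close>

text \<open>Topological groups are Hausdorff by convention.\<close>

locale topological_group = group G for G :: "('a, 'b) monoid_scheme" (structure) +
  fixes T :: "'a topology"
  assumes topspace_eq: "topspace T = carrier G"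
    and Hausdorff: "Hausdorff_space T"
    and continuous_mult: "continuous_map (prod_topology T T) T (\<lambda>(x, y). x \<otimes> y)"
    and continuous_inv: "continuous_map T T (\<lambda>x. inv x)"


section \<open>Groups given by generators and relations\<close>

text \<open>
  A letter \<open>(v, True)\<close> stands for the generator \<open>v\<close> and \<open>(v, False)\<close> for its formal inverse.
  A pair \<open>(r, s)\<close> of words stands for the relation \<open>r = s\<close>.
\<close>

type_synonym 'v word = "('v \<times> bool) list"

definition words :: "'v set \<Rightarrow> 'v word set" where
  "words V = lists (V \<times> UNIV)"

lemma words_simps [simp]:
  "[] \<in> words V"
  "l # w \<in> words V \<longleftrightarrow> fst l \<in> V \<and> w \<in> words V"
  "u @ w \<in> words V \<longleftrightarrow> u \<in> words V \<and> w \<in> words V"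
  by (auto simp: words_def mem_Times_iff)

inductive_set word_cong :: "'v set \<Rightarrow> ('v word \<times> 'v word) set \<Rightarrow> ('v word \<times> 'v word) set"
  for V R where
  refl: "u \<in> words V \<Longrightarrow> (u, u) \<in> word_cong V R"
| sym: "(u, w) \<in> word_cong V R \<Longrightarrow> (w, u) \<in> word_cong V R"
| trans: "(u, w) \<in> word_cong V R \<Longrightarrow> (w, x) \<in> word_cong V R \<Longrightarrow> (u, x) \<in> word_cong V R"
| cancel: "u \<in> words V \<Longrightarrow> w \<in> words V \<Longrightarrow> v \<in> V
    \<Longrightarrow> (u @ [(v, b), (v, \<not> b)] @ w, u @ w) \<in> word_cong V R"
| rel: "u \<in> words V \<Longrightarrow> w \<in> words V \<Longrightarrow> (r, s) \<in> R \<Longrightarrow> r \<in> words V \<Longrightarrow> s \<in> words V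
    \<Longrightarrow> (u @ r @ w, u @ s @ w) \<in> word_cong V R"

definition presented_group :: "'v set \<Rightarrow> ('v word \<times> 'v word) set \<Rightarrow> 'v word set monoid" where
  "presented_group V R =
    \<lparr> carrier = words V // word_cong V R,
      mult = (\<lambda>A B. \<Union>a\<in>A. \<Union>b\<in>B. word_cong V R `` {a @ b}),
      one = word_cong V R `` {[]} \<rparr>"

text \<open>
  The lemmas \<open>group_presented_group\<close>, \<open>presented_group_universal\<close> and
  \<open>presented_group_hom_unique\<close> show that this is the group \<open>\<langle>V | R\<rangle>\<close>: it has the universal property of the presentation.
\<close>

lemma word_cong_words:
  "(u, w) \<in> word_cong V R \<Longrightarrow> u \<in> words V \<and> w \<in> words V"
  by (induction rule: word_cong.induct) auto

lemma equiv_word_cong: "equiv (words V) (word_cong V R)"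
proof (rule equivI)
  show "word_cong V R \<subseteq> words V \<times> words V"
    by (auto dest: word_cong_words)
  show "refl_on (words V) (word_cong V R)"
    by (rule refl_onI) (rule word_cong.refl)
  show "sym (word_cong V R)"
    by (rule symI) (rule word_cong.sym)
  show "trans (word_cong V R)"
    by (rule transI) (rule word_cong.trans)
qed

lemma word_cong_append_both:
  assumes "(u, w) \<in> word_cong V R" "x \<in> words V" "y \<in> words V"
  shows "(x @ u @ y, x @ w @ y) \<in> word_cong V R"
  using assms
proof (induction rule: word_cong.induct)
  case (refl u)
  then show ?case by (intro word_cong.refl) auto
next
  case (sym u w)
  then show ?case by (blast intro: word_cong.sym)
next
  case (trans u w x)
  then show ?case by (blast intro: word_cong.trans)
next
  case (cancel u w v b)
  then show ?case
    using word_cong.cancel[of "x @ u" V "w @ y" v b R] by simp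
next
  case (rel u w r s)
  then show ?case
    using word_cong.rel[of "x @ u" V "w @ y" r s R] by simp
qed

lemma word_cong_append:
  assumes "(a, a') \<in> word_cong V R" "(b, b') \<in> word_cong V R"
  shows "(a @ b, a' @ b') \<in> word_cong V R"
proof -
  have "(a @ b, a' @ b) \<in> word_cong V R"
    using word_cong_append_both[OF assms(1), of "[]" b] word_cong_words[OF assms(2)] by simp
  moreover have "(a' @ b, a' @ b') \<in> word_cong V R"
    using word_cong_append_both[OF assms(2), of a' "[]"] word_cong_words[OF assms(1)] by simp
  ultimately show ?thesis by (rule word_cong.trans)
qed

definition word_class :: "'v set \<Rightarrow> ('v word \<times> 'v word) set \<Rightarrow> 'v word \<Rightarrow> 'v word set" where
  "word_class V R w = word_cong V R `` {w}"

lemma word_class_eq_iff: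
  assumes "u \<in> words V" "w \<in> words V"
  shows "word_class V R u = word_class V R w \<longleftrightarrow> (u, w) \<in> word_cong V R"
  unfolding word_class_def using assms by (simp add: eq_equiv_class_iff[OF equiv_word_cong])

lemma carrier_presented_group: "carrier (presented_group V R) = word_class V R ` words V"
  by (auto simp: presented_group_def quotient_def word_class_def)

lemma one_presented_group: "\<one>\<^bsub>presented_group V R\<^esub> = word_class V R []"
  by (simp add: presented_group_def word_class_def)

lemma mult_presented_group:
  assumes "a \<in> words V" "b \<in> words V"
  shows "word_class V R a \<otimes>\<^bsub>presented_group V R\<^esub> word_class V R b = word_class V R (a @ b)"
proof -
  have "(\<lambda>a b. word_cong V R `` {a @ b}) respects2 word_cong V R"
    by (intro congruent2I' equiv_class_eq[OF equiv_word_cong] word_cong_append)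
  then show ?thesis
    unfolding presented_group_def word_class_def
    using UN_equiv_class2[OF equiv_word_cong equiv_word_cong _ assms] by simp
qed

definition inv_word :: "'v word \<Rightarrow> 'v word" where
  "inv_word w = rev (map (\<lambda>(v, b). (v, \<not> b)) w)"

lemma inv_word_words: "w \<in> words V \<Longrightarrow> inv_word w \<in> words V"
  by (auto simp: inv_word_def words_def)

lemma inv_word_cancel:
  assumes "w \<in> words V"
  shows "(inv_word w @ w, []) \<in> word_cong V R"
  using assms
proof (induction w)
  case Nil
  then show ?case by (simp add: inv_word_def word_cong.refl)
next
  case (Cons l w)
  obtain v b where l: "l = (v, b)" by (cases l)
  have "(inv_word w @ [(v, \<not> b), (v, \<not> \<not> b)] @ w, inv_word w @ w) \<in> word_cong V R"
    using Cons.prems l by (intro word_cong.cancel inv_word_words) auto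
  moreover have "(inv_word w @ w, []) \<in> word_cong V R"
    using Cons by simp
  ultimately show ?case
    using word_cong.trans by (fastforce simp: inv_word_def l)
qed

lemma group_presented_group: "group (presented_group V R)"
proof (rule groupI)
  fix x y z
  assume "x \<in> carrier (presented_group V R)" "y \<in> carrier (presented_group V R)"
    "z \<in> carrier (presented_group V R)"
  then show "x \<otimes>\<^bsub>presented_group V R\<^esub> y \<otimes>\<^bsub>presented_group V R\<^esub> z =
      x \<otimes>\<^bsub>presented_group V R\<^esub> (y \<otimes>\<^bsub>presented_group V R\<^esub> z)"
    by (auto simp: carrier_presented_group mult_presented_group)
next
  fix x assume "x \<in> carrier (presented_group V R)"
  then obtain w where w: "w \<in> words V" "x = word_class V R w"
    by (auto simp: carrier_presented_group)
  then have "word_class V R (inv_word w) \<otimes>\<^bsub>presented_group V R\<^esub> x = \<one>\<^bsub>presented_group V R\<^esub>"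
    by (simp add: mult_presented_group inv_word_words one_presented_group word_class_eq_iff
        inv_word_cancel)
  then show "\<exists>y\<in>carrier (presented_group V R). y \<otimes>\<^bsub>presented_group V R\<^esub> x = \<one>\<^bsub>presented_group V R\<^esub>"
    using w inv_word_words by (auto simp: carrier_presented_group)
qed (auto simp: carrier_presented_group mult_presented_group one_presented_group)

definition eval_word :: "('h, 'b) monoid_scheme \<Rightarrow> ('v \<Rightarrow> 'h) \<Rightarrow> 'v word \<Rightarrow> 'h" where
  "eval_word H g w =
    foldr (\<lambda>(v, b) x. (if b then g v else inv\<^bsub>H\<^esub> (g v)) \<otimes>\<^bsub>H\<^esub> x) w \<one>\<^bsub>H\<^esub>"

lemma (in group) eval_word_closed:
  assumes "g \<in> V \<rightarrow> carrier G" "w \<in> words V"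
  shows "eval_word G g w \<in> carrier G"
  using assms(2)
proof (induction w)
  case (Cons l w)
  then show ?case using assms(1) by (cases l) (auto simp: eval_word_def Pi_iff)
qed (simp add: eval_word_def)

lemma (in group) eval_word_append:
  assumes g: "g \<in> V \<rightarrow> carrier G" and "u \<in> words V" and w: "w \<in> words V"
  shows "eval_word G g (u @ w) = eval_word G g u \<otimes> eval_word G g w"
  using assms(2)
proof (induction u)
  case Nil
  then show ?case using eval_word_closed[OF g w] by (simp add: eval_word_def)
next
  case (Cons l u)
  obtain v b where l: "l = (v, b)" by (cases l)
  have "eval_word G g u \<in> carrier G" "eval_word G g w \<in> carrier G" "g v \<in> carrier G"
    using Cons.prems l g w eval_word_closed[OF g] by auto
  then show ?case using Cons by (simp add: eval_word_def l m_assoc)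
qed

lemma (in group) eval_word_cong:
  assumes "(u, w) \<in> word_cong V R" and g: "g \<in> V \<rightarrow> carrier G"
    and R: "\<And>r s. (r, s) \<in> R \<Longrightarrow> eval_word G g r = eval_word G g s"
  shows "eval_word G g u = eval_word G g w"
  using assms(1)
proof (induction rule: word_cong.induct)
  case (cancel u w v b)
  have gv: "g v \<in> carrier G" using cancel g by auto
  then have "eval_word G g [(v, b), (v, \<not> b)] = \<one>"
    by (cases b) (simp_all add: eval_word_def)
  then show ?case
    using cancel eval_word_closed[OF g]
    by (simp add: eval_word_append[OF g] del: append_Cons)
next
  case (rel u w r s)
  then show ?case using R by (simp add: eval_word_append[OF g])
qed auto

theorem presented_group_universal:
  fixes H :: "('h, 'b) monoid_scheme"
  assumes "group H" and g: "g \<in> V \<rightarrow> carrier H"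
    and R: "\<And>r s. (r, s) \<in> R \<Longrightarrow> eval_word H g r = eval_word H g s"
  shows "\<exists>h\<in>hom (presented_group V R) H. \<forall>v\<in>V. h (word_class V R [(v, True)]) = g v"
proof -
  interpret group H by fact
  define h where "h A = eval_word H g (SOME w. w \<in> A)" for A
  have h: "h (word_class V R w) = eval_word H g w" if "w \<in> words V" for w
  proof -
    have "w \<in> word_class V R w"
      using word_cong.refl[OF that] by (simp add: word_class_def)
    then have "(SOME x. x \<in> word_class V R w) \<in> word_class V R w" by (rule someI)
    then have "(w, SOME x. x \<in> word_class V R w) \<in> word_cong V R"
      by (simp add: word_class_def)
    then show ?thesis
      unfolding h_def using eval_word_cong[OF _ g R] by metis
  qed
  have "h \<in> hom (presented_group V R) H"
    using g by (auto intro!: homI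
        simp: carrier_presented_group mult_presented_group h eval_word_append eval_word_closed)
  moreover have "h (word_class V R [(v, True)]) = g v" if "v \<in> V" for v
    using that g by (simp add: h Pi_iff) (simp add: eval_word_def Pi_iff)
  ultimately show ?thesis by blast
qed

lemma presented_group_hom_unique:
  fixes H :: "('h, 'b) monoid_scheme"
  assumes "group H" "h \<in> hom (presented_group V R) H" "w \<in> words V"
  shows "h (word_class V R w) = eval_word H (\<lambda>v. h (word_class V R [(v, True)])) w"
proof -
  interpret group_hom "presented_group V R" H h
    using assms group_presented_group by (simp add: group_hom_def group_hom_axioms_def)
  show ?thesis using assms(3)
  proof (induction w)
    case Nil
    then show ?case using hom_one by (simp add: eval_word_def one_presented_group)
  next
    case (Cons l w)
    obtain v b where l: "l = (v, b)" by (cases l)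
    have v: "v \<in> V" and w: "w \<in> words V" using Cons.prems l by auto
    have cv: "word_class V R [(v, c)] \<in> carrier (presented_group V R)" for c
      using v by (auto simp: carrier_presented_group)
    have "word_class V R [(v, False)] \<otimes>\<^bsub>presented_group V R\<^esub> word_class V R [(v, True)]
        = \<one>\<^bsub>presented_group V R\<^esub>"
      using v inv_word_cancel[of "[(v, True)]" V R]
      by (simp add: mult_presented_group one_presented_group word_class_eq_iff inv_word_def)
    then have "inv\<^bsub>presented_group V R\<^esub> word_class V R [(v, True)] = word_class V R [(v, False)]"
      using cv by (intro G.inv_equality) auto
    then have "h (word_class V R [(v, False)]) = inv\<^bsub>H\<^esub> (h (word_class V R [(v, True)]))"
      using hom_inv[OF cv] by metis
    moreover have "h (word_class V R (l # w)) = h (word_class V R [l]) \<otimes>\<^bsub>H\<^esub> h (word_class V R w)"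
      using mult_presented_group[of "[l]" V w R] v w l cv
        hom_mult[of "word_class V R [l]" "word_class V R w"]
      by (simp add: carrier_presented_group)
    ultimately show ?case
      using Cons w by (cases b) (simp_all add: eval_word_def l)
  qed
qed


section \<open>Right-angled Artin groups\<close>

definition raag :: "'v pair_pre_digraph \<Rightarrow> 'v word set monoid" where
  "raag \<Gamma> = presented_group (pverts \<Gamma>)
    {([(v, True), (w, True)], [(w, True), (v, True)]) | v w. (v, w) \<in> parcs \<Gamma>}"

end

theory Submission
  imports Defs
begin

text \<open>
  The theorem is an instance of a method of Dudley. A \<^emph>\<open>norm\<close> on a group is taken here to be a
  subadditive function \<open>N\<close> to the natural numbers that does not decrease when one passes from an
  element to a positive power, and such that \<open>N (x ^ n) \<ge> n\<close> for every \<open>x \<noteq> 1\<close>. Two facts are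
  proved: every homomorphism from a locally compact group to a discrete group with such a norm is
  continuous, and word length is such a norm on a right-angled Artin group.

  \<^bold>\<open>Continuity.\<close> If the kernel of \<open>f\<close> were not open, then every neighbourhood of the identity would
  contain elements outside the kernel. One can then choose such elements \<open>x\<^sub>n\<close> one after
  another so close to the identity that the infinitely nested expression
  \<open>y\<^sub>0 = x\<^sub>0 (x\<^sub>1 (x\<^sub>2 (\<dots>)^k\<^sub>2)^k\<^sub>1)^k\<^sub>0\<close>
  makes sense: all truncations stay in a compact set, and compactness of an infinite power of this set
  (\<open>coherent_sequence_exists\<close>) gives \<open>y\<^sub>n\<close> with \<open>y\<^sub>n = x\<^sub>n y\<^sub>n\<^sub>+\<^sub>1 ^ k\<^sub>n\<close> for all \<open>n\<close>. The exponents
  may be taken as large as desired compared with the norms of the inverses of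
  \<open>f x\<^sub>0, \<dots>, f x\<^sub>n\<close>. But in a
  normed group the existence of such large roots forces \<open>f y\<^sub>n = 1\<close>, and hence \<open>f x\<^sub>n = 1\<close>, for all
  large \<open>n\<close> (\<open>trivial_equation\<close>), a contradiction.

  \<^bold>\<open>Word length.\<close> A word over the generators and their inverses is reduced if no letter can be moved
  next to an occurrence of its inverse by commutations. Reducing letter by letter from the right gives a normal
  form that is well defined up to commutations (\<open>trace_eq_red\<close>), so all reduced words for an
  element have the same, minimal length. Every element has a reduced word of the form
  \<open>x z x\<^sup>-\<^sup>1\<close> with \<open>z z\<close> reduced (\<open>cyclic_reduction\<close>). Then \<open>x z\<^sup>n x\<^sup>-\<^sup>1\<close> is reduced for all \<open>n \<ge> 1\<close>
  (\<open>irreducible_conj_pow\<close>), so the length of the \<open>n\<close>-th power is \<open>2 |x| + n |z|\<close>, and the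
  required inequalities can be read off.
\<close>

section \<open>Homomorphisms from locally compact groups to normed groups\<close>

locale dudley_normed_group = group G for G (structure) +
  fixes N :: "'a \<Rightarrow> nat"
  assumes triangle: "x \<in> carrier G \<Longrightarrow> y \<in> carrier G \<Longrightarrow> N (x \<otimes> y) \<le> N x + N y"
    and norm_le_pow: "x \<in> carrier G \<Longrightarrow> n > 0 \<Longrightarrow> N x \<le> N (x [^] n)"
    and pow_growth: "x \<in> carrier G \<Longrightarrow> x \<noteq> \<one> \<Longrightarrow> n \<le> N (x [^] (n::nat))"

text \<open>
  Write \<open>s n\<close> for the sum of the norms of \<open>inv (h i)\<close>, \<open>i < n\<close>. Since passing to a power
  does not decrease the norm, \<open>N (g n) \<le> N (g 0) + s n\<close> by induction. If \<open>g (Suc n)\<close> is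
  nontrivial, then its \<open>k n\<close>-th power has norm at least \<open>k n > n + s (Suc n)\<close>, and at most
  \<open>N (g 0) + s (Suc n)\<close>, so that \<open>n < N (g 0)\<close>. Hence two consecutive terms of the
  sequence \<open>g\<close> are trivial, and the equation relating them makes a term of \<open>h\<close> trivial.
\<close>
lemma (in dudley_normed_group) trivial_equation:
  fixes k :: "nat \<Rightarrow> nat"
  assumes h: "\<And>n. h n \<in> carrier G" and g: "\<And>n. g n \<in> carrier G"
    and eq: "\<And>n. g n = h n \<otimes> g (Suc n) [^] k n"
    and k: "\<And>n. k n \<ge> Suc n + (\<Sum>i\<le>n. N (inv (h i)))"
  shows "\<exists>n. h n = \<one>"
proof -
  have step: "N (g (Suc n) [^] k n) \<le> N (inv (h n)) + N (g n)" for n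
  proof -
    have "g (Suc n) [^] k n = inv (h n) \<otimes> g n"
      using eq[of n] h g by (metis inv_solve_left nat_pow_closed)
    then show ?thesis using triangle h g by simp
  qed
  have pos: "k n > 0" for n using k[of n] by simp
  have bound: "N (g n) \<le> N (g 0) + (\<Sum>i<n. N (inv (h i)))" for n
  proof (induction n)
    case (Suc n)
    have "N (g (Suc n)) \<le> N (g (Suc n) [^] k n)" using norm_le_pow g pos by blast
    then show ?case using step[of n] Suc by simp
  qed simp
  have triv: "g (Suc n) = \<one>" if "n \<ge> N (g 0)" for n
  proof (rule ccontr)
    assume "g (Suc n) \<noteq> \<one>"
    then have "k n \<le> N (g (Suc n) [^] k n)" using pow_growth g by blast
    also have "\<dots> \<le> N (g 0) + (\<Sum>i\<le>n. N (inv (h i)))"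
      using step[of n] bound[of n] by (simp add: lessThan_Suc_atMost[symmetric])
    finally show False using k[of n] that by simp
  qed
  define n where "n = N (g 0)"
  have "g (Suc n) = \<one>" "g (Suc (Suc n)) = \<one>" using triv by (simp_all add: n_def)
  then have "h (Suc n) = \<one>" using eq[of "Suc n"] h by simp
  then show ?thesis by blast
qed

text \<open>
  Solutions of the first \<open>m\<close> equations are found by choosing a late entry freely and computing
  backwards; the sets \<open>W n\<close> keep them in \<open>K\<close>. The solution sets of the single equations are closed
  in the infinite power of the space, so compactness of the power of \<open>K\<close> gives a common solution.
\<close>
lemma coherent_sequence_exists:
  assumes "Hausdorff_space T" and K: "compactin T K"
    and cont: "\<And>n. continuous_map T T (\<phi> n)"
    and W: "\<And>n. W n \<subseteq> K" "\<And>n. W n \<noteq> {}" "\<And>n::nat. \<phi> n ` W (Suc n) \<subseteq> W n"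
  shows "\<exists>y. (\<forall>n. y n \<in> K) \<and> (\<forall>n. y n = \<phi> n (y (Suc n)))"
proof -
  let ?P = "product_topology (\<lambda>_. T) (UNIV :: nat set)"
  define C where "C n = {y \<in> topspace ?P. y n = \<phi> n (y (Suc n))}" for n
  have proj: "continuous_map ?P T (\<lambda>y. y n)" for n
    by (rule continuous_map_product_projection) simp
  have closed: "closedin ?P (C n)" for n
    unfolding C_def
    by (rule closedin_continuous_maps_eq[OF assms(1) proj])
       (use continuous_map_compose[OF proj cont] in \<open>simp add: o_def\<close>)
  have compact: "compactin ?P (PiE UNIV (\<lambda>_. K))"
    using K by (simp add: compactin_PiE)
  have partial: "\<exists>y. (\<forall>n. y n \<in> W n) \<and> (\<forall>n. a \<le> n \<and> n < a + d \<longrightarrow> y n = \<phi> n (y (Suc n)))"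
    for a d
  proof (induction d arbitrary: a)
    case 0
    have "\<forall>n. \<exists>y. y \<in> W n" using W(2) by blast
    then obtain y where "\<forall>n. y n \<in> W n" using choice by metis
    then show ?case by auto
  next
    case (Suc d)
    obtain y where y: "\<forall>n. y n \<in> W n"
      "\<forall>n. Suc a \<le> n \<and> n < Suc a + d \<longrightarrow> y n = \<phi> n (y (Suc n))"
      using Suc[of "Suc a"] by blast
    let ?y = "y(a := \<phi> a (y (Suc a)))"
    have "?y n \<in> W n" for n using y(1) W(3)[of a] by auto
    moreover have "?y n = \<phi> n (?y (Suc n))" if "a \<le> n" "n < a + Suc d" for n
      using y(2) that by (cases "n = a") auto
    ultimately show ?case by blast
  qed
  have fip: "PiE UNIV (\<lambda>_. K) \<inter> \<Inter>\<F> \<noteq> {}" if F: "finite \<F>" "\<F> \<subseteq> range C" for \<F>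
  proof -
    obtain I where I: "finite I" "\<F> = C ` I" using finite_subset_image[OF F] by blast
    obtain m where m: "\<And>n. n \<in> I \<Longrightarrow> n < m"
      using I(1) finite_nat_set_iff_bounded by auto
    obtain y where y: "\<forall>n. y n \<in> W n" "\<forall>n. n < m \<longrightarrow> y n = \<phi> n (y (Suc n))"
      using partial[of 0 m] by auto
    have "y \<in> PiE UNIV (\<lambda>_. K)" using y(1) W(1) by (auto simp: PiE_UNIV_domain)
    moreover have "K \<subseteq> topspace T" using K by (rule compactin_subset_topspace)
    ultimately have "y \<in> PiE UNIV (\<lambda>_. K) \<inter> \<Inter>\<F>"
      using y(2) m by (auto simp: I(2) C_def PiE_UNIV_domain)
    then show ?thesis by blast
  qed
  have "PiE UNIV (\<lambda>_. K) \<inter> \<Inter>(range C) \<noteq> {}"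
  proof (rule compact[unfolded compactin_fip, THEN conjunct2, rule_format], intro conjI ballI allI impI)
    show "closedin ?P S" if "S \<in> range C" for S using that closed by blast
    show "PiE UNIV (\<lambda>_. K) \<inter> \<Inter>\<F> \<noteq> {}" if "finite \<F> \<and> \<F> \<subseteq> range C" for \<F>
      using fip that by blast
  qed
  then show ?thesis by (auto simp: C_def PiE_UNIV_domain)
qed

context topological_group
begin

lemma continuous_map_mult:
  assumes "continuous_map X T f" "continuous_map X T g"
  shows "continuous_map X T (\<lambda>x. f x \<otimes> g x)"
  using continuous_map_compose[OF continuous_map_pairedI[OF assms] continuous_mult]
  by (simp add: o_def)

lemma continuous_map_pow: "continuous_map T T (\<lambda>x. x [^] (n::nat))"
proof (induction n)
  case 0
  then show ?case by (simp add: topspace_eq)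
next
  case (Suc n)
  then show ?case using continuous_map_mult[OF Suc continuous_map_id[unfolded id_def]] by simp
qed

lemma continuous_map_mult_pow:
  assumes "x \<in> carrier G"
  shows "continuous_map T T (\<lambda>y. x \<otimes> y [^] (n::nat))"
  using assms by (intro continuous_map_mult continuous_map_pow) (simp add: topspace_eq)

end

theorem (in dudley_normed_group) open_kernel:
  fixes L :: "('l, 'm) monoid_scheme" and T :: "'l topology"
  assumes L: "topological_group L T" and lc: "locally_compact_space T" and f: "f \<in> hom L G"
  shows "\<exists>U. openin T U \<and> \<one>\<^bsub>L\<^esub> \<in> U \<and> (\<forall>x\<in>U. f x = \<one>)"
proof (rule ccontr)
  interpret L: topological_group L T by fact
  interpret f: group_hom L G f
    using f by (intro group_hom.intro L.group_axioms group_axioms group_hom_axioms.intro)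
  assume "\<not> ?thesis"
  then have nontriv: "\<exists>x\<in>U. f x \<noteq> \<one>" if "openin T U" "\<one>\<^bsub>L\<^esub> \<in> U" for U
    using that by blast
  obtain U K where UK: "openin T U" "compactin T K" "\<one>\<^bsub>L\<^esub> \<in> U" "U \<subseteq> K"
    using lc L.topspace_eq by (metis L.one_closed locally_compact_space_def)
  (* One step of the choice picks a neighbourhood W of 1, an element x of W outside the kernel and an exponent k.
     Since y = 1 is mapped to x, which lies in W, the map taking y to x y^k sends a smaller
     neighbourhood of 1 into W. The lower bounds on k add up to those required in trivial_equation. *)
  define P where "P = (\<lambda>(W, x, k::nat). openin T W \<and> \<one>\<^bsub>L\<^esub> \<in> W \<and> W \<subseteq> K \<and>
    x \<in> W \<and> f x \<noteq> \<one> \<and> Suc (N (inv (f x))) \<le> k)"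
  define Q where "Q = (\<lambda>(W, x, k::nat) (W', x', k'::nat).
    (\<lambda>y. x \<otimes>\<^bsub>L\<^esub> y [^]\<^bsub>L\<^esub> k) ` W' \<subseteq> W \<and> k + Suc (N (inv (f x'))) \<le> k')"
  have "\<exists>s. \<forall>n. P (s n) \<and> Q (s n) (s (Suc n))"
  proof (rule dependent_nat_choice)
    obtain x where "x \<in> U" "f x \<noteq> \<one>" using nontriv UK by blast
    then show "\<exists>s. P s" using UK by (intro exI[of _ "(U, x, Suc (N (inv (f x))))"]) (simp add: P_def)
  next
    fix s and n :: nat assume "P s"
    obtain W x k where s: "s = (W, x, k)" by (metis prod_cases3)
    have W: "openin T W" "\<one>\<^bsub>L\<^esub> \<in> W" "W \<subseteq> K" "x \<in> W" using \<open>P s\<close> by (auto simp: s P_def)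
    have x: "x \<in> carrier L" using W(1,4) openin_subset L.topspace_eq by blast
    define W' where "W' = {y \<in> topspace T. x \<otimes>\<^bsub>L\<^esub> y [^]\<^bsub>L\<^esub> k \<in> W} \<inter> U"
    have W': "openin T W'" "\<one>\<^bsub>L\<^esub> \<in> W'"
      using openin_continuous_map_preimage[OF L.continuous_map_mult_pow[OF x] W(1)] UK W x
      by (auto simp: W'_def L.topspace_eq)
    obtain x' where "x' \<in> W'" "f x' \<noteq> \<one>" using nontriv W' by blast
    then show "\<exists>s'. P s' \<and> Q s s'"
      using W' UK(4)
      by (intro exI[of _ "(W', x', k + Suc (N (inv (f x'))))"]) (auto simp: P_def Q_def s W'_def)
  qed
  then obtain s where s: "\<And>n. P (s n)" "\<And>n. Q (s n) (s (Suc n))" by blast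
  define W where "W n = fst (s n)" for n
  define x where "x n = fst (snd (s n))" for n
  define k where "k n = snd (snd (s n))" for n
  have s_eq: "s n = (W n, x n, k n)" for n by (simp add: W_def x_def k_def)
  have W: "openin T (W n)" "\<one>\<^bsub>L\<^esub> \<in> W n" "W n \<subseteq> K" "x n \<in> W n" "f (x n) \<noteq> \<one>"
    "Suc (N (inv (f (x n)))) \<le> k n" for n
    using s(1)[of n] by (auto simp: s_eq P_def)
  have step: "(\<lambda>y. x n \<otimes>\<^bsub>L\<^esub> y [^]\<^bsub>L\<^esub> k n) ` W (Suc n) \<subseteq> W n"
    "k n + Suc (N (inv (f (x (Suc n))))) \<le> k (Suc n)" for n
    using s(2)[of n] by (auto simp: s_eq Q_def)
  have x: "x n \<in> carrier L" for n using W(1,4) openin_subset L.topspace_eq by blast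
  have "\<exists>y. (\<forall>n. y n \<in> K) \<and> (\<forall>n. y n = x n \<otimes>\<^bsub>L\<^esub> y (Suc n) [^]\<^bsub>L\<^esub> k n)"
    by (rule coherent_sequence_exists[where W = W and T = T])
       (use L.Hausdorff UK(2) L.continuous_map_mult_pow[OF x] W step(1) in blast)+
  then obtain y where y: "\<And>n. y n \<in> K" "\<And>n. y n = x n \<otimes>\<^bsub>L\<^esub> y (Suc n) [^]\<^bsub>L\<^esub> k n" by blast
  have yL: "y n \<in> carrier L" for n
    using y(1) compactin_subset_topspace[OF UK(2)] L.topspace_eq by blast
  have "\<exists>n. f (x n) = \<one>"
  proof (rule trivial_equation[where g = "\<lambda>n. f (y n)" and k = k])
    show "f (y n) = f (x n) \<otimes> f (y (Suc n)) [^] k n" for n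
      using arg_cong[OF y(2)[of n], of f] x yL by (simp add: f.hom_nat_pow)
    show "k n \<ge> Suc n + (\<Sum>i\<le>n. N (inv (f (x i))))" for n
    proof (induction n)
      case 0
      then show ?case using W(6)[of 0] by simp
    next
      case (Suc n)
      then show ?case using step(2)[of n] by simp
    qed
  qed (use x yL in auto)
  then show False using W(5) by blast
qed

theorem (in dudley_normed_group) continuous_hom:
  fixes L :: "('l, 'm) monoid_scheme" and T :: "'l topology"
  assumes L: "topological_group L T" and lc: "locally_compact_space T" and f: "f \<in> hom L G"
  shows "continuous_map T (discrete_topology (carrier G)) f"
proof -
  interpret L: topological_group L T by fact
  interpret f: group_hom L G f
    using f by (intro group_hom.intro L.group_axioms group_axioms group_hom_axioms.intro)
  obtain U where U: "openin T U" "\<one>\<^bsub>L\<^esub> \<in> U" "\<And>x. x \<in> U \<Longrightarrow> f x = \<one>"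
    using open_kernel[OF assms] by blast
  have "openin T {x \<in> topspace T. f x \<in> S}" for S
  proof (subst openin_subopen, intro ballI)
    fix a assume "a \<in> {x \<in> topspace T. f x \<in> S}"
    then have a: "a \<in> carrier L" "f a \<in> S" by (auto simp: L.topspace_eq)
    define W where "W = {y \<in> topspace T. inv\<^bsub>L\<^esub> a \<otimes>\<^bsub>L\<^esub> y \<in> U}"
    have "openin T W" unfolding W_def
      using a by (intro openin_continuous_map_preimage[OF _ U(1)] L.continuous_map_mult)
        (auto simp: L.topspace_eq)
    moreover have "a \<in> W" using a U(2) by (simp add: W_def L.topspace_eq)
    moreover have "y \<in> {x \<in> topspace T. f x \<in> S}" if "y \<in> W" for y
    proof -
      have y: "y \<in> carrier L" "inv\<^bsub>L\<^esub> a \<otimes>\<^bsub>L\<^esub> y \<in> U" using that by (auto simp: W_def L.topspace_eq)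
      have "inv (f a) \<otimes> f y = \<one>" using U(3)[OF y(2)] a y(1) by simp
      then have "f y = f a" using a y by (metis f.hom_closed inv_closed inv_equality inv_inv)
      then show ?thesis using a y(1) by (simp add: L.topspace_eq)
    qed
    ultimately show "\<exists>W. openin T W \<and> a \<in> W \<and> W \<subseteq> {x \<in> topspace T. f x \<in> S}"
      by blast
  qed
  then show ?thesis by (auto simp: continuous_map_def L.topspace_eq)
qed

section \<open>Reduced words up to commutation\<close>

definition inv_letter :: "'v \<times> bool \<Rightarrow> 'v \<times> bool" where
  "inv_letter l = (fst l, \<not> snd l)"

lemma inv_letter_simps [simp]:
  "fst (inv_letter l) = fst l" "inv_letter (inv_letter l) = l"
  "inv_letter l \<noteq> l" "l \<noteq> inv_letter l"
  by (auto simp: inv_letter_def prod_eq_iff)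

lemma inv_word_simps [simp]:
  "inv_word [] = []" "inv_word (u @ w) = inv_word w @ inv_word u" "inv_word [l] = [inv_letter l]"
  by (auto simp: inv_word_def inv_letter_def split: prod.splits)

lemma remove1_words: "w \<in> words V \<Longrightarrow> remove1 l w \<in> words V"
  using set_remove1_subset[of l w] by (auto simp: words_def)

locale commutation_graph =
  fixes V :: "'v set" and E :: "('v \<times> 'v) set"
  assumes arcs: "E \<subseteq> V \<times> V" and sym: "sym E" and irrefl: "irrefl E"
begin

definition commutes :: "'v \<times> bool \<Rightarrow> 'v word \<Rightarrow> bool" where
  "commutes l w \<longleftrightarrow> (\<forall>m\<in>set w. (fst l, fst m) \<in> E)"

lemma commutes_simps [simp]:
  "commutes l []"
  "commutes l (m # w) \<longleftrightarrow> (fst l, fst m) \<in> E \<and> commutes l w"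
  "commutes l (u @ w) \<longleftrightarrow> commutes l u \<and> commutes l w"
  "commutes l (rev w) \<longleftrightarrow> commutes l w"
  "commutes (inv_letter l) w \<longleftrightarrow> commutes l w"
  by (auto simp: commutes_def)

lemma no_loop [simp]: "(v, v) \<notin> E"
  using irrefl by (simp add: irrefl_def)

lemma arc_sym: "(v, w) \<in> E \<longleftrightarrow> (w, v) \<in> E"
  using sym by (auto dest: symD)

lemma arc_neq: "(fst l, fst m) \<in> E \<Longrightarrow> m \<noteq> l \<and> m \<noteq> inv_letter l"
  by auto

text \<open>
  A word starts with \<open>l\<close> if commutations can bring an occurrence of \<open>l\<close> to the front. As a vertex is
  not adjacent to itself, this must be the first letter of \<open>w\<close> at the vertex of \<open>l\<close>.
\<close>
fun starts :: "'v \<times> bool \<Rightarrow> 'v word \<Rightarrow> bool" where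
  "starts l [] = False"
| "starts l (m # w) = (m = l \<or> (fst l, fst m) \<in> E \<and> starts l w)"

definition ends :: "'v \<times> bool \<Rightarrow> 'v word \<Rightarrow> bool" where
  "ends l w = starts l (rev w)"

fun reducible :: "'v word \<Rightarrow> bool" where
  "reducible [] = False"
| "reducible (l # w) = (reducible w \<or> starts (inv_letter l) w)"

lemma starts_append: "starts l (u @ w) \<longleftrightarrow> starts l u \<or> commutes l u \<and> starts l w"
  by (induction u) auto

lemma reducible_append:
  "reducible (u @ w) \<longleftrightarrow> reducible u \<or> reducible w \<or> (\<exists>l. ends l u \<and> starts (inv_letter l) w)"
proof (induction u)
  case (Cons x u)
  have ends_Cons: "ends l (x # u) \<longleftrightarrow> ends l u \<or> commutes l u \<and> x = l" for l
    by (auto simp: ends_def starts_append)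
  show ?case
    using Cons unfolding append_Cons reducible.simps starts_append ends_Cons
    by (metis commutes_simps(5) inv_letter_simps(2))
qed (simp add: ends_def)

lemma starts_split: "starts l w \<Longrightarrow> \<exists>p q. w = p @ l # q \<and> commutes l p"
proof (induction w)
  case (Cons m w)
  show ?case
  proof (cases "m = l")
    case True
    then have "m # w = [] @ l # w \<and> commutes l []" by simp
    then show ?thesis by blast
  next
    case False
    then obtain p q where "w = p @ l # q" "commutes l p" "(fst l, fst m) \<in> E"
      using Cons by auto
    then have "m # w = (m # p) @ l # q \<and> commutes l (m # p)" by simp
    then show ?thesis by blast
  qed
qed simp

lemma ends_split:
  assumes "ends l w" shows "\<exists>p q. w = p @ l # q \<and> commutes l q"
proof -
  obtain p q where pq: "rev w = p @ l # q" "commutes l p"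
    using starts_split[of l "rev w"] assms by (auto simp: ends_def)
  have "w = rev q @ l # rev p"
    using arg_cong[OF pq(1), of rev] by simp
  then show ?thesis using pq(2) by (intro exI[of _ "rev q"] exI[of _ "rev p"]) simp
qed

lemma starts_remove1:
  assumes "starts l w" "(fst m, fst l) \<in> E"
  shows "starts m (remove1 l w) \<longleftrightarrow> starts m w"
  using assms(1)
proof (induction w)
  case (Cons x w)
  then show ?case using assms(2) by (cases "x = l") auto
qed simp

text \<open>
  Deleting the letter \<open>l\<close> could only create a cancellation between letters \<open>x\<close> before it and
  \<open>inv_letter x\<close> after it; but \<open>x\<close> commutes with \<open>l\<close>, so they would have cancelled before.
\<close>
lemma reducible_remove1:
  assumes "starts l w" "\<not> reducible w"
  shows "\<not> reducible (remove1 l w)"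
  using assms
proof (induction w)
  case (Cons x w)
  then show ?case
    using starts_remove1[of l w "inv_letter x"] arc_sym[of "fst x" "fst l"] by (cases "x = l") auto
qed simp

lemma reducible_if_starts_remove1:
  assumes "starts l w" "starts (inv_letter l) (remove1 l w)"
  shows "reducible w"
  using assms
proof (induction w)
  case (Cons x w)
  then show ?case by (cases "x = l") auto
qed simp

text \<open>
  On letters at pairwise nonadjacent vertices commutations have no effect. The projections of a word
  to the independent sets of vertices therefore determine it up to commutations; equality of these
  projections (\<open>trace_eq\<close>) replaces commutation equivalence in what follows.
\<close>
definition independent :: "'v set \<Rightarrow> bool" where
  "independent S \<longleftrightarrow> (\<forall>v\<in>S. \<forall>w\<in>S. (v, w) \<notin> E)"

definition proj :: "'v set \<Rightarrow> 'v word \<Rightarrow> 'v word" where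
  "proj S = filter (\<lambda>l. fst l \<in> S)"

definition trace_eq :: "'v word \<Rightarrow> 'v word \<Rightarrow> bool" where
  "trace_eq u w \<longleftrightarrow> (\<forall>S. independent S \<longrightarrow> proj S u = proj S w)"

lemma proj_starts:
  assumes "starts l w" "independent S" "fst l \<in> S"
  shows "\<exists>t. proj S w = l # t"
  using assms(1)
proof (induction w)
  case (Cons m w)
  then show ?case using assms(2,3) by (cases "m = l") (auto simp: proj_def independent_def)
qed simp

text \<open>
  A letter \<open>m\<close> in front of \<open>l\<close> that does not commute with it is detected by the projection to
  the two vertices of \<open>l\<close> and \<open>m\<close>, which is a set with one element if the vertices agree.
\<close>
lemma starts_iff_proj:
  "starts l w \<longleftrightarrow> (\<forall>S. independent S \<longrightarrow> fst l \<in> S \<longrightarrow> (\<exists>t. proj S w = l # t))"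
proof
  assume "\<forall>S. independent S \<longrightarrow> fst l \<in> S \<longrightarrow> (\<exists>t. proj S w = l # t)"
  then show "starts l w"
  proof (induction w)
    case Nil
    from Nil[rule_format, of "{fst l}"] show ?case by (auto simp: proj_def independent_def)
  next
    case (Cons m w)
    show ?case
    proof (cases "(fst l, fst m) \<in> E")
      case True
      then have "proj S (m # w) = proj S w" if "independent S" "fst l \<in> S" for S
        using that by (auto simp: proj_def independent_def)
      then show ?thesis using Cons True by simp
    next
      case False
      then have "independent {fst l, fst m}" using arc_sym by (auto simp: independent_def)
      from Cons.prems[rule_format, OF this] show ?thesis by (auto simp: proj_def)
    qed
  qed
qed (use proj_starts in blast)

lemma trace_eq_starts: "trace_eq u w \<Longrightarrow> starts l u \<longleftrightarrow> starts l w"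
  by (simp add: starts_iff_proj trace_eq_def)

text \<open>The projections to single vertices already count every letter.\<close>
lemma trace_eq_length:
  assumes "trace_eq u w" shows "length u = length w"
proof -
  have "count (mset u) l = count (mset w) l" for l
  proof -
    have "proj {fst l} u = proj {fst l} w"
      using assms by (simp add: trace_eq_def independent_def)
    moreover have "count (mset x) l = count (mset (proj {fst l} x)) l" for x
      by (simp add: proj_def)
    ultimately show ?thesis by metis
  qed
  then have "mset u = mset w" by (rule multiset_eqI)
  then show ?thesis by (rule mset_eq_length)
qed

text \<open>
  Left multiplication by a letter, on reduced words. Up to commutations it respects the defining
  relations of the group (\<open>push_cancel\<close>, \<open>push_commute\<close>), so it amounts to an action of
  the group on reduced words, and \<open>red w\<close> is the result of applying \<open>w\<close> to the empty word.
\<close>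
definition push :: "'v \<times> bool \<Rightarrow> 'v word \<Rightarrow> 'v word" where
  "push l w = (if starts (inv_letter l) w then remove1 (inv_letter l) w else l # w)"

definition red :: "'v word \<Rightarrow> 'v word" where
  "red w = foldr push w []"

lemma red_simps [simp]: "red [] = []" "red (l # w) = push l (red w)"
  by (simp_all add: red_def)

lemma red_append: "red (u @ w) = foldr push u (red w)"
  by (simp add: red_def)

lemma proj_push:
  assumes "independent S"
  shows "proj S (push l w) =
    (if fst l \<notin> S then proj S w
     else if starts (inv_letter l) w then remove1 (inv_letter l) (proj S w) else l # proj S w)"
  by (auto simp: push_def proj_def filter_remove1 remove1_idem)

lemma trace_eq_push: "trace_eq u w \<Longrightarrow> trace_eq (push l u) (push l w)"
  using trace_eq_starts[of u w "inv_letter l"] by (simp add: trace_eq_def proj_push)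

lemma trace_eq_foldr_push: "trace_eq u w \<Longrightarrow> trace_eq (foldr push x u) (foldr push x w)"
  by (induction x) (simp_all add: trace_eq_push)

lemma push_irreducible: "\<not> reducible w \<Longrightarrow> \<not> reducible (push l w)"
  by (simp add: push_def reducible_remove1)

lemma red_irreducible: "\<not> reducible (red w)"
  by (induction w) (simp_all add: push_irreducible)

lemma red_id: "\<not> reducible w \<Longrightarrow> red w = w"
  by (induction w) (auto simp: push_def)

text \<open>
  The point is that in a reduced word deleting \<open>l\<close> does not expose \<open>inv_letter l\<close>, so that the
  second push restores \<open>l\<close> instead of deleting a further letter.
\<close>
lemma push_cancel:
  assumes "\<not> reducible w"
  shows "trace_eq (push l (push (inv_letter l) w)) w"
proof (cases "starts l w")
  case True
  then have "\<not> starts (inv_letter l) (remove1 l w)"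
    using assms reducible_if_starts_remove1 by blast
  then have "push l (push (inv_letter l) w) = l # remove1 l w"
    using True by (simp add: push_def)
  moreover have "trace_eq (l # remove1 l w) w"
    unfolding trace_eq_def
  proof (intro allI impI)
    fix S assume S: "independent S"
    show "proj S (l # remove1 l w) = proj S w"
      using proj_starts[OF True S] by (auto simp: proj_def filter_remove1 remove1_idem)
  qed
  ultimately show ?thesis by simp
next
  case False
  then show ?thesis by (simp add: push_def trace_eq_def)
qed

lemma starts_push:
  assumes "(fst l, fst m) \<in> E"
  shows "starts l (push m w) \<longleftrightarrow> starts l w"
proof -
  have "m \<noteq> l" using arc_neq[OF assms] by simp
  then show ?thesis
    using assms by (auto simp: push_def starts_remove1[where m = l])
qed

lemma push_commute:
  assumes "(fst l, fst m) \<in> E"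
  shows "trace_eq (push l (push m w)) (push m (push l w))"
proof -
  have "(fst m, fst l) \<in> E" using assms arc_sym by blast
  with assms have "starts (inv_letter l) (push m w) \<longleftrightarrow> starts (inv_letter l) w"
    "starts (inv_letter m) (push l w) \<longleftrightarrow> starts (inv_letter m) w"
    by (simp_all add: starts_push)
  with assms show ?thesis
    by (auto simp: trace_eq_def proj_push) (auto simp: independent_def)
qed

lemma length_push: "length (push l w) \<le> Suc (length w)"
  by (auto simp: push_def length_remove1)

lemma length_red: "length (red w) \<le> length w"
proof (induction w)
  case (Cons l w)
  then show ?case using length_push[of l "red w"] by simp
qed simp

lemma irreducible_if_length_red:
  "length (red w) = length w \<Longrightarrow> \<not> reducible w"
proof (induction w)
  case (Cons l w)
  have "length (red w) = length w"
    using Cons.prems length_push[of l "red w"] length_red[of w] by simp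
  then have w: "\<not> reducible w" using Cons.IH by blast
  then have "length (push l w) = Suc (length w)"
    using Cons.prems by (simp add: red_id)
  then have "\<not> starts (inv_letter l) w"
    by (auto simp: push_def length_remove1 split: if_splits)
  then show ?case using w by simp
qed simp


section \<open>Word length in a right-angled Artin group\<close>

abbreviation relations :: "('v word \<times> 'v word) set" where
  "relations \<equiv> {([(v, True), (w, True)], [(w, True), (v, True)]) | v w. (v, w) \<in> E}"

abbreviation cong :: "('v word \<times> 'v word) set" where
  "cong \<equiv> word_cong V relations"

text \<open>
  This solves the word problem: congruent words have the same normal form up to commutations.
\<close>
lemma trace_eq_red:
  assumes "(u, w) \<in> cong" shows "trace_eq (red u) (red w)"
  using assms
proof (induction rule: word_cong.induct)
  case (cancel u w v b)
  have "trace_eq (push (v, b) (push (inv_letter (v, b)) (red w))) (red w)"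
    by (rule push_cancel[OF red_irreducible])
  then show ?case
    by (simp add: red_append inv_letter_def trace_eq_foldr_push)
next
  case (rel u w r s)
  then obtain a c where "r = [(a, True), (c, True)]" "s = [(c, True), (a, True)]" "(a, c) \<in> E"
    by auto
  then show ?case
    using push_commute[of "(a, True)" "(c, True)"] by (simp add: red_append trace_eq_foldr_push)
qed (auto simp: trace_eq_def)

lemma cong_cancel: "fst l \<in> V \<Longrightarrow> ([l, inv_letter l], []) \<in> cong"
  using word_cong.cancel[of "[]" V "[]" "fst l" "snd l" relations]
  by (simp add: inv_letter_def)

lemma cong_swap_inv:
  assumes "([l, m], [m, l]) \<in> cong"
  shows "([inv_letter l, m], [m, inv_letter l]) \<in> cong"
proof -
  let ?i = "inv_letter l"
  have V: "fst l \<in> V" "fst m \<in> V" using word_cong_words[OF assms] by auto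
  have "([?i, m] @ [l, ?i], [?i, m]) \<in> cong"
    using word_cong_append_both[OF cong_cancel[OF V(1)], of "[?i, m]" "[]"] V by simp
  moreover have "([?i] @ [l, m] @ [?i], [?i] @ [m, l] @ [?i]) \<in> cong"
    using word_cong_append_both[OF assms, of "[?i]" "[?i]"] V by simp
  moreover have "([?i, l] @ [m, ?i], [m, ?i]) \<in> cong"
    using word_cong_append_both[OF cong_cancel[of ?i], of "[]" "[m, ?i]"] V by simp
  ultimately show ?thesis
    by simp (meson word_cong.sym word_cong.trans)
qed

text \<open>
  The presentation only has the relations between positive letters; those that involve inverses
  follow.
\<close>
lemma cong_swap:
  assumes "(fst l, fst m) \<in> E"
  shows "([l, m], [m, l]) \<in> cong"
proof -
  obtain v b w c where lm: "l = (v, b)" "m = (w, c)" by (cases l, cases m)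
  have vw: "(v, w) \<in> E" "v \<in> V" "w \<in> V" using assms arcs by (auto simp: lm)
  have pos: "([(v, True), (w, True)], [(w, True), (v, True)]) \<in> cong"
    using word_cong.rel[of "[]" V "[]" "[(v, True), (w, True)]" "[(w, True), (v, True)]" relations] vw
    by auto
  have "([(v, b), (w, True)], [(w, True), (v, b)]) \<in> cong"
    using pos cong_swap_inv[OF pos] by (cases b) (auto simp: inv_letter_def)
  from word_cong.sym[OF this] cong_swap_inv[OF word_cong.sym[OF this]]
  have "([(w, c), (v, b)], [(v, b), (w, c)]) \<in> cong"
    by (cases c) (auto simp: inv_letter_def)
  then show ?thesis unfolding lm by (rule word_cong.sym)
qed

lemma cong_commutes:
  assumes "commutes l p" "fst l \<in> V" "p \<in> words V"
  shows "(p @ [l], l # p) \<in> cong"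
  using assms
proof (induction p)
  case Nil
  then show ?case by (auto intro: word_cong.refl)
next
  case (Cons m p)
  then have "(m # p @ [l], m # l # p) \<in> cong"
    using word_cong_append_both[of "p @ [l]" "l # p" V relations "[m]" "[]"] by simp
  moreover have "([l, m] @ p, [m, l] @ p) \<in> cong"
    using word_cong_append_both[OF cong_swap[of l m], of "[]" p] Cons.prems by simp
  ultimately show ?case
    by simp (meson word_cong.sym word_cong.trans)
qed

lemma cong_starts:
  assumes "starts l w" "w \<in> words V"
  shows "(w, l # remove1 l w) \<in> cong"
proof -
  obtain p q where pq: "w = p @ l # q" "commutes l p"
    using starts_split[OF assms(1)] by blast
  have "l \<notin> set p" using pq(2) by (auto simp: commutes_def)
  then have "remove1 l w = p @ q" using pq(1) by (simp add: remove1_append)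
  moreover have "((p @ [l]) @ q, (l # p) @ q) \<in> cong"
    using word_cong_append_both[OF cong_commutes[OF pq(2)], of "[]" q] assms(2) pq(1) by simp
  ultimately show ?thesis using pq(1) by simp
qed

lemma cong_push:
  assumes "fst l \<in> V" "w \<in> words V"
  shows "(l # w, push l w) \<in> cong"
proof (cases "starts (inv_letter l) w")
  case True
  let ?r = "remove1 (inv_letter l) w"
  have r: "?r \<in> words V" using assms(2) by (rule remove1_words)
  have "([l] @ w, [l] @ inv_letter l # ?r) \<in> cong"
    using word_cong_append_both[OF cong_starts[OF True assms(2)], of "[l]" "[]"] assms by simp
  moreover have "([l, inv_letter l] @ ?r, ?r) \<in> cong"
    using word_cong_append_both[OF cong_cancel[OF assms(1)], of "[]" ?r] r by simp
  ultimately show ?thesis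
    using True by (simp add: push_def) (meson word_cong.trans)
next
  case False
  then show ?thesis using assms by (auto simp: push_def intro: word_cong.refl)
qed

lemma cong_red:
  assumes "w \<in> words V" shows "(w, red w) \<in> cong"
  using assms
proof (induction w)
  case Nil
  then show ?case by (auto intro: word_cong.refl)
next
  case (Cons l w)
  then have w: "(w, red w) \<in> cong" "fst l \<in> V" by auto
  have "(l # w, l # red w) \<in> cong"
    using word_cong_append_both[OF w(1), of "[l]" "[]"] w(2) by simp
  moreover have "(l # red w, push l (red w)) \<in> cong"
    using cong_push w word_cong_words by blast
  ultimately show ?case by simp (meson word_cong.trans)
qed

lemma length_red_cong: "(u, w) \<in> cong \<Longrightarrow> length (red u) = length (red w)"
  by (intro trace_eq_length trace_eq_red)

text \<open>
  If \<open>z\<close> is reduced, then a cancellation in \<open>z @ z\<close> is between a letter that can be moved to the end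
  of the first copy and its inverse, which can be moved to the beginning of the second. In \<open>z\<close>
  these are different letters, and \<open>z\<close> is conjugate to a word shorter by two.
\<close>
lemma cyclic_reduction_step:
  assumes "\<not> reducible z" "reducible (z @ z)" "z \<in> words V"
  shows "\<exists>l y. fst l \<in> V \<and> y \<in> words V \<and> length z = length y + 2 \<and> (z, l # y @ [inv_letter l]) \<in> cong"
proof -
  obtain l where l: "ends (inv_letter l) z" "starts l z"
    using assms(1,2) reducible_append[of z z] by (metis inv_letter_simps(2))
  obtain p q where pq: "z = p @ inv_letter l # q" "commutes l q"
    using ends_split[OF l(1)] by auto
  have "starts l p"
    using l(2) pq(2) unfolding pq(1) starts_append by auto
  then have z1: "(p, l # remove1 l p) \<in> cong"
    using assms(3) pq(1) by (intro cong_starts) auto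
  let ?r = "remove1 l p"
  have r: "?r \<in> words V" and V: "fst l \<in> V" "q \<in> words V" "p \<in> words V"
    using assms(3) pq(1) remove1_words[of p V l] by auto
  have len: "length p = Suc (length ?r)"
    using \<open>starts l p\<close> starts_split[OF \<open>starts l p\<close>] by (auto simp: length_remove1)
  have "(q @ [inv_letter l], inv_letter l # q) \<in> cong"
    using cong_commutes[of "inv_letter l" q] pq(2) V by simp
  from word_cong_append[OF z1 word_cong.sym[OF this]]
  have "(z, l # (?r @ q) @ [inv_letter l]) \<in> cong"
    using pq(1) by simp
  then show ?thesis
    using r V pq(1) len by (intro exI[of _ l] exI[of _ "?r @ q"]) auto
qed

text \<open>
  Among the words \<open>x @ z @ inv_word x\<close> for the given element whose length is minimal, one with
  shortest \<open>z\<close> is taken; minimal length makes it reduced.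
\<close>
lemma cyclic_reduction:
  assumes "\<not> reducible w" "w \<in> words V"
  shows "\<exists>x z. (w, x @ z @ inv_word x) \<in> cong \<and> \<not> reducible (x @ z @ inv_word x) \<and> \<not> reducible (z @ z)"
proof -
  define good where "good x z \<longleftrightarrow>
    (w, x @ z @ inv_word x) \<in> cong \<and> length (x @ z @ inv_word x) = length w" for x z
  have irr: "\<not> reducible (x @ z @ inv_word x)" if "good x z" for x z
    using that length_red_cong[of w "x @ z @ inv_word x"] assms(1)
    by (intro irreducible_if_length_red) (auto simp: good_def red_id)
  have "good [] w" using assms(2) by (auto simp: good_def intro: word_cong.refl)
  then obtain x z where xz: "good x z" and min: "\<And>x' z'. good x' z' \<Longrightarrow> length z \<le> length z'"
    using ex_has_least_nat[of "\<lambda>z. \<exists>x. good x z" w length] by blast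
  have "\<not> reducible (z @ z)"
  proof
    assume "reducible (z @ z)"
    moreover have "\<not> reducible z" using irr[OF xz] by (simp add: reducible_append)
    moreover have words: "x @ z @ inv_word x \<in> words V"
      using xz word_cong_words unfolding good_def by blast
    ultimately obtain l y where ly: "fst l \<in> V" "y \<in> words V" "length z = length y + 2"
      "(z, l # y @ [inv_letter l]) \<in> cong"
      using cyclic_reduction_step[of z] by auto
    have "(x @ z @ inv_word x, x @ (l # y @ [inv_letter l]) @ inv_word x) \<in> cong"
      using word_cong_append_both[OF ly(4), of x "inv_word x"] words by simp
    then have "(w, (x @ [l]) @ y @ inv_word (x @ [l])) \<in> cong"
      using xz by (auto simp: good_def intro: word_cong.trans)
    then have "good (x @ [l]) y"
      using xz ly(3) by (simp add: good_def)
    then show False using min ly(3) by fastforce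
  qed
  then show ?thesis using xz irr[OF xz] by (auto simp: good_def)
qed

lemma reducible_across:
  assumes "reducible (u @ t @ w)" "\<not> reducible (u @ t)" "\<not> reducible (t @ w)"
  shows "\<exists>l. ends l u \<and> commutes l t \<and> starts (inv_letter l) w"
  using assms by (auto simp: reducible_append starts_append)

lemma not_starts_if_commutes: "commutes l w \<Longrightarrow> \<not> starts l w"
  by (induction w) auto

lemma ends_append: "ends l (u @ w) \<longleftrightarrow> ends l w \<or> commutes l w \<and> ends l u"
  by (simp add: ends_def starts_append)

lemma concat_replicate_Suc_right:
  "concat (replicate (Suc n) z) = concat (replicate n z) @ z"
  by (induction n) auto

text \<open>
  A cancellation between letters in different factors, with a copy of \<open>z\<close> in between, requires that
  these letters commute with all of \<open>z\<close>. So neither of them can lie in another copy of \<open>z\<close>.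
  In the next lemma only letters of \<open>x\<close> and \<open>y\<close> remain, and these would cancel already
  in \<open>x @ z @ y\<close>.
\<close>
lemma irreducible_pow:
  assumes zz: "\<not> reducible (z @ z)" and xz: "\<not> reducible (x @ z)"
  shows "\<not> reducible (x @ concat (replicate (Suc n) z))"
proof (induction n)
  case 0
  then show ?case using xz by simp
next
  case (Suc n)
  show ?case
  proof
    assume "reducible (x @ concat (replicate (Suc (Suc n)) z))"
    then have "reducible ((x @ concat (replicate n z)) @ z @ z)"
      by (simp add: concat_replicate_Suc_right del: replicate_Suc)
    moreover have "\<not> reducible ((x @ concat (replicate n z)) @ z)"
      using Suc by (simp add: concat_replicate_Suc_right del: replicate_Suc)
    ultimately obtain l where "commutes l z" "starts (inv_letter l) z"
      using reducible_across zz by blast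
    then show False using not_starts_if_commutes[of "inv_letter l" z] by simp
  qed
qed

lemma irreducible_conj_pow:
  assumes zz: "\<not> reducible (z @ z)" and xzy: "\<not> reducible (x @ z @ y)"
  shows "\<not> reducible (x @ concat (replicate (Suc n) z) @ y)"
proof
  let ?p = "concat (replicate n z)"
  assume "reducible (x @ concat (replicate (Suc n) z) @ y)"
  then have "reducible ((x @ ?p) @ z @ y)"
    by (simp add: concat_replicate_Suc_right del: replicate_Suc)
  moreover have "\<not> reducible (x @ z)" "\<not> reducible (z @ y)"
    using xzy reducible_append[of "x @ z" y] reducible_append[of x "z @ y"] by auto
  moreover from irreducible_pow[OF zz this(1), of n] have "\<not> reducible ((x @ ?p) @ z)"
    by (simp add: concat_replicate_Suc_right del: replicate_Suc)
  ultimately obtain l where l: "ends l (x @ ?p)" "commutes l z" "starts (inv_letter l) y"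
    using reducible_across by blast
  have "commutes l (rev ?p)"
    using l(2) by (auto simp: commutes_def)
  then have "ends l x"
    using l(1) not_starts_if_commutes[of l "rev ?p"] by (auto simp: ends_append ends_def starts_append)
  moreover have "starts (inv_letter l) (z @ y)"
    using l by (simp add: starts_append)
  ultimately show False
    using xzy reducible_append[of x "z @ y"] by blast
qed

abbreviation artin :: "'v word set monoid" where
  "artin \<equiv> presented_group V relations"

abbreviation cls :: "'v word \<Rightarrow> 'v word set" where
  "cls \<equiv> word_class V relations"

definition word_length :: "'v word set \<Rightarrow> nat" where
  "word_length g = (LEAST n. n \<in> length ` g)"

lemma word_length_cls:
  assumes "w \<in> words V" shows "word_length (cls w) = length (red w)"
  unfolding word_length_def
proof (rule Least_equality)
  show "length (red w) \<in> length ` cls w"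
    using cong_red[OF assms] by (auto simp: word_class_def)
next
  fix n assume "n \<in> length ` cls w"
  then obtain u where "(w, u) \<in> cong" "n = length u" by (auto simp: word_class_def)
  then show "length (red w) \<le> n" using length_red_cong[of w u] length_red[of u] by simp
qed

lemma cls_conj_pow:
  assumes "x \<in> words V" "z \<in> words V"
  shows "cls (x @ z @ inv_word x) [^]\<^bsub>artin\<^esub> Suc n =
    cls (x @ concat (replicate (Suc n) z) @ inv_word x)"
proof -
  interpret group artin by (rule group_presented_group)
  show ?thesis
  proof (induction n)
    case 0
    have "cls (x @ z @ inv_word x) \<in> carrier artin"
      using assms by (simp add: carrier_presented_group inv_word_words)
    then show ?case by simp
  next
    case (Suc n)
    define p where "p = concat (replicate (Suc n) z)"
    have p: "p \<in> words V" using assms(2) by (auto simp: words_def p_def)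
    have x': "inv_word x \<in> words V" using assms(1) by (rule inv_word_words)
    have "((x @ p) @ (inv_word x @ x) @ (z @ inv_word x), (x @ p) @ [] @ (z @ inv_word x)) \<in> cong"
      by (rule word_cong_append_both[OF inv_word_cancel[OF assms(1)]]) (simp_all add: assms p x')
    then have "cls ((x @ p @ inv_word x) @ (x @ z @ inv_word x)) = cls (x @ (p @ z) @ inv_word x)"
      using assms p x' by (simp add: word_class_eq_iff)
    moreover have "cls (x @ z @ inv_word x) [^]\<^bsub>artin\<^esub> Suc (Suc n) =
        cls (x @ p @ inv_word x) \<otimes>\<^bsub>artin\<^esub> cls (x @ z @ inv_word x)"
      unfolding p_def by (simp only: Suc.IH[symmetric] nat_pow_Suc)
    moreover have "concat (replicate (Suc (Suc n)) z) = p @ z"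
      unfolding p_def by (rule concat_replicate_Suc_right)
    ultimately show ?case
      using assms p x' by (simp only: mult_presented_group words_simps)
  qed
qed

lemma length_concat_replicate: "length (concat (replicate n z)) = n * length z"
  by (induction n) auto

text \<open>
  For a reduced word \<open>x @ z @ inv_word x\<close> with \<open>z @ z\<close> reduced, \<open>k = 2 * length x\<close> and
  \<open>m = length z\<close>.
\<close>
lemma word_length_pow:
  assumes g: "g \<in> carrier artin"
  shows "\<exists>k m. word_length g = k + m \<and> (g \<noteq> \<one>\<^bsub>artin\<^esub> \<longrightarrow> m > 0) \<and>
    (\<forall>n. word_length (g [^]\<^bsub>artin\<^esub> Suc n) = k + Suc n * m)"
proof -
  obtain w0 where w0: "w0 \<in> words V" "g = cls w0"
    using g by (auto simp: carrier_presented_group)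
  define w where "w = red w0"
  have w0w: "(w0, w) \<in> cong" using cong_red[OF w0(1)] by (simp add: w_def)
  then have w: "w \<in> words V" using word_cong_words by blast
  have gw: "g = cls w" using w0w w0 w by (simp add: word_class_eq_iff)
  have "\<not> reducible w" by (simp add: w_def red_irreducible)
  from cyclic_reduction[OF this w] obtain x z where
    xz: "(w, x @ z @ inv_word x) \<in> cong" "\<not> reducible (x @ z @ inv_word x)" "\<not> reducible (z @ z)"
    by blast
  have words: "x @ z @ inv_word x \<in> words V" using xz(1) word_cong_words by blast
  then have xV: "x \<in> words V" and zV: "z \<in> words V" by auto
  have gxz: "g = cls (x @ z @ inv_word x)"
    using gw xz(1) w words by (simp add: word_class_eq_iff)
  have len: "word_length (g [^]\<^bsub>artin\<^esub> Suc n) = 2 * length x + Suc n * length z" for n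
  proof -
    have p: "concat (replicate (Suc n) z) \<in> words V" using zV by (auto simp: words_def)
    have "g [^]\<^bsub>artin\<^esub> Suc n = cls (x @ concat (replicate (Suc n) z) @ inv_word x)"
      unfolding gxz by (rule cls_conj_pow[OF xV zV])
    moreover have "length (inv_word x) = length x" by (simp add: inv_word_def)
    ultimately show ?thesis
      using irreducible_conj_pow[OF xz(3,2), of n] words p
      by (simp add: word_length_cls red_id length_concat_replicate del: replicate_Suc)
  qed
  interpret group artin by (rule group_presented_group)
  have "word_length g = 2 * length x + length z" using len[of 0] g by simp
  moreover have "length z > 0" if "g \<noteq> \<one>\<^bsub>artin\<^esub>"
  proof (rule ccontr)
    assume "\<not> length z > 0"
    then have "g [^]\<^bsub>artin\<^esub> Suc 1 = cls (x @ z @ inv_word x)"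
      unfolding gxz using cls_conj_pow[OF xV zV, of 1] by simp
    then have "g \<otimes>\<^bsub>artin\<^esub> g = g" using gxz g by simp
    then show False using that g by (simp add: r_cancel_one)
  qed
  ultimately show ?thesis using len by blast
qed

end

lemma (in commutation_graph) dudley_normed_group_artin: "dudley_normed_group artin word_length"
proof -
  interpret group artin by (rule group_presented_group)
  show ?thesis
  proof
    fix g h assume "g \<in> carrier artin" "h \<in> carrier artin"
    then obtain u w where uw: "u \<in> words V" "w \<in> words V" "g = cls u" "h = cls w"
      by (auto simp: carrier_presented_group)
    have "length (red (u @ w)) = length (red (red u @ red w))"
      using uw cong_red by (intro length_red_cong word_cong_append)
    also have "\<dots> \<le> length (red u) + length (red w)"
      using length_red[of "red u @ red w"] by simp
    finally show "word_length (g \<otimes>\<^bsub>artin\<^esub> h) \<le> word_length g + word_length h"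
      using uw by (simp add: mult_presented_group word_length_cls)
  next
    fix g and n :: nat assume g: "g \<in> carrier artin" and "n > 0"
    then obtain m where m: "n = Suc m" by (cases n) auto
    obtain k c where "word_length g = k + c"
      "\<And>n. word_length (g [^]\<^bsub>artin\<^esub> Suc n) = k + Suc n * c"
      using word_length_pow[OF g] by blast
    then show "word_length g \<le> word_length (g [^]\<^bsub>artin\<^esub> n)"
      by (simp add: m del: nat_pow_Suc)
  next
    fix g and n :: nat assume g: "g \<in> carrier artin" "g \<noteq> \<one>\<^bsub>artin\<^esub>"
    show "n \<le> word_length (g [^]\<^bsub>artin\<^esub> n)"
    proof (cases n)
      case (Suc m)
      obtain k c where c: "c > 0" "\<And>n. word_length (g [^]\<^bsub>artin\<^esub> Suc n) = k + Suc n * c"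
        using word_length_pow[OF g(1)] g(2) by blast
      have "Suc m * 1 \<le> Suc m * c" using c(1) by (intro mult_le_mono) auto
      then show ?thesis unfolding Suc c(2) by simp
    qed simp
  qed
qed

theorem corollaryD:
  fixes L :: "('a, 'b) monoid_scheme" and T :: "'a topology"
    and \<Gamma> :: "'v pair_pre_digraph" and f :: "'a \<Rightarrow> 'v word set"
  assumes "topological_group L T" and "locally_compact_space T"
    and "pair_graph \<Gamma>"
    and "f \<in> hom L (raag \<Gamma>)"
  shows "continuous_map T (discrete_topology (carrier (raag \<Gamma>))) f"
proof -
  interpret \<Gamma>: pair_graph \<Gamma> by fact
  interpret commutation_graph "pverts \<Gamma>" "parcs \<Gamma>"
  proof
    show "parcs \<Gamma> \<subseteq> pverts \<Gamma> \<times> pverts \<Gamma>"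
      using \<Gamma>.arc_fst_in_verts \<Gamma>.arc_snd_in_verts by fastforce
    show "sym (parcs \<Gamma>)"
      using \<Gamma>.pair_sym_arcs by (auto simp: symmetric_def)
    show "irrefl (parcs \<Gamma>)"
      using \<Gamma>.pair_no_loops by (fastforce simp: irrefl_def)
  qed
  interpret dudley_normed_group "raag \<Gamma>" word_length
    using dudley_normed_group_artin by (simp add: raag_def)
  show ?thesis using assms(1,2,4) by (rule continuous_hom)
qed

end
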